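(* Let $n\ge1$, $w\in\mathbb{R}^n_{>0}$, $1/2\le\beta<1$, $0\le\theta<1$, $c_0\in\mathbb{R}^n$, $r_0>0$, $B_0=\mathcal{B}(c_0,r_0w)$, $x^*\in B_0$ and $f\in\mathcal{M}_w(\theta,x^*,B_0)$. With $R_k=\beta^kr_0$ define $$b_0=r_0,\qquad b_{k+1}=\max\{\,b_k-(1-\beta)R_k,\ \theta b_k+(1-\beta)R_k\,\}.$$ Then for every tie rule the sequence generated by Cube-Sign$(\beta,w)$ from $B_0$ satisfies $M_k\le b_k$ for every $k\ge0$. Moreover: (i) if $\theta\le2\beta-1$, then $b_k=R_k$ for all $k$; (ii) if $\theta>2\beta-1$, the index $$J=\min\Bigl\{k:\ \frac{b_k}{R_k}\ge\frac{2(1-\beta)}{1-\theta}\Bigr\}$$ is finite, the first argument of the maximum is at least the second for every $k\ge J$, and $b_k=b_J-R_J+R_k$ for all $k\ge J$. In particular, $M_\infty\le b_J-R_J$.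
   Context: $\mathcal{B}(c,r)=\{x:|x_i-c_i|\le r_i\ \forall i\}$; $\|u\|_{\infty,w}=\max_i|u_i|/w_i$. Algorithm Cube-Sign$(\beta,w)$: from $c_0$, $r_0>0$, put $R_k=\beta^kr_0$. At step $k$ take $s_k\in\{-1,+1\}^n$ with $s_{k,i}=\operatorname{sign}\partial_if(c_k)$ whenever $\partial_if(c_k)\ne0$; if $\partial_if(c_k)=0$, $s_{k,i}\in\{-1,+1\}$ is chosen by a tie rule (any rule depending only on query points, sign answers and previous choices). Then $c_{k+1}=c_k-(1-\beta)R_k\,w\odot s_k$. $M_k=\|c_k-x^*\|_{\infty,w}$; since the steps are summable, the limits $c_\infty=\lim c_k$ and $M_\infty=\lim M_k=\|c_\infty-x^*\|_{\infty,w}$ exist. Defect class $\mathcal{M}_w(\theta,x^*,B)$ (for $x^*\in B$, $0\le\theta<1$): functions $f$ differentiable on a neighbourhood of $B$ such that for every $x\in B$ and every $i$, $|x_i-x_i^*|/w_i>\theta\|x-x^*\|_{\infty,w}$ implies $\partial_if(x)(x_i-x_i^* )>0$. *)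

theory Defs
  imports "HOL-Analysis.Analysis"
begin

definition coord_box :: "real ^ 'n \<Rightarrow> real ^ 'n \<Rightarrow> (real ^ 'n) set"
  where "coord_box c r = {x. \<forall>i. \<bar>x $ i - c $ i\<bar> \<le> r $ i}"

definition wnorm :: "real ^ 'n \<Rightarrow> real ^ 'n \<Rightarrow> real"
  where "wnorm w u = (MAX i. \<bar>u $ i\<bar> / w $ i)"

definition partial_deriv :: "(real ^ 'n \<Rightarrow> real) \<Rightarrow> 'n \<Rightarrow> real ^ 'n \<Rightarrow> real"
  where "partial_deriv f i x = deriv (\<lambda>t. f (x + t *\<^sub>R axis i 1)) 0"

text \<open>Functions are total here; the values of \<open>f\<close> away from the neighbourhood \<open>U\<close> are
  unconstrained. The side conditions \<open>xs \<in> B\<close> and \<open>0 \<le> \<theta> < 1\<close> of the class are not part of the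
  definition and have to be assumed where it is used.\<close>

definition defect_class ::
    "real ^ 'n \<Rightarrow> real \<Rightarrow> real ^ 'n \<Rightarrow> (real ^ 'n) set \<Rightarrow> (real ^ 'n \<Rightarrow> real) set"
  where "defect_class w \<theta> xs B =
    {f. (\<exists>U. open U \<and> B \<subseteq> U \<and> (\<forall>x\<in>U. f differentiable (at x))) \<and>
        (\<forall>x\<in>B. \<forall>i. \<bar>x $ i - xs $ i\<bar> / w $ i > \<theta> * wnorm w (x - xs) \<longrightarrow>
            partial_deriv f i x * (x $ i - xs $ i) > 0)}"

definition sign_answers :: "(real ^ 'n \<Rightarrow> real) \<Rightarrow> real ^ 'n \<Rightarrow> real ^ 'n"
  where "sign_answers f x = (\<chi> i. sgn (partial_deriv f i x))"

text \<open>A transcript lists, for each completed step in chronological order, the query point, the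
  vector of sign answers in \<open>{-1, 0, 1}\<close>, and the vector of signs that was used. A tie rule sees
  the transcript together with the current query point and its sign answers, and proposes a sign
  for every coordinate; only the proposals at coordinates with answer \<open>0\<close> are used. A rule may
  depend on the step number, which is the length of the transcript.\<close>

type_synonym 'n transcript = "((real ^ 'n) \<times> (real ^ 'n) \<times> (real ^ 'n)) list"
type_synonym 'n tie_rule = "'n transcript \<Rightarrow> real ^ 'n \<Rightarrow> real ^ 'n \<Rightarrow> real ^ 'n"

definition is_tie_rule :: "('n::finite) tie_rule \<Rightarrow> bool"
  where "is_tie_rule \<tau> \<longleftrightarrow> (\<forall>h x a i. \<tau> h x a $ i \<in> {-1, 1})"

definition chosen_signs :: "('n::finite) tie_rule \<Rightarrow> 'n transcript \<Rightarrow> real ^ 'n \<Rightarrow> real ^ 'n \<Rightarrow> real ^ 'n"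
  where "chosen_signs \<tau> h x a = (\<chi> i. if a $ i \<noteq> 0 then a $ i else \<tau> h x a $ i)"

definition radius :: "real \<Rightarrow> real \<Rightarrow> nat \<Rightarrow> real"
  where "radius \<beta> r0 k = \<beta> ^ k * r0"

primrec cube_sign_state ::
    "real \<Rightarrow> real ^ 'n \<Rightarrow> ('n::finite) tie_rule \<Rightarrow> (real ^ 'n \<Rightarrow> real) \<Rightarrow> real ^ 'n \<Rightarrow> real \<Rightarrow> nat
      \<Rightarrow> (real ^ 'n) \<times> 'n transcript"
  where
    "cube_sign_state \<beta> w \<tau> f c0 r0 0 = (c0, [])"
  | "cube_sign_state \<beta> w \<tau> f c0 r0 (Suc k) =
      (let (c, h) = cube_sign_state \<beta> w \<tau> f c0 r0 k;
           a = sign_answers f c;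
           s = chosen_signs \<tau> h c a
       in (c - ((1 - \<beta>) * radius \<beta> r0 k) *\<^sub>R (\<chi> i. w $ i * s $ i), h @ [(c, a, s)]))"

definition cube_sign ::
    "real \<Rightarrow> real ^ 'n \<Rightarrow> ('n::finite) tie_rule \<Rightarrow> (real ^ 'n \<Rightarrow> real) \<Rightarrow> real ^ 'n \<Rightarrow> real \<Rightarrow> nat
      \<Rightarrow> real ^ 'n"
  where "cube_sign \<beta> w \<tau> f c0 r0 k = fst (cube_sign_state \<beta> w \<tau> f c0 r0 k)"

primrec bound_seq :: "real \<Rightarrow> real \<Rightarrow> real \<Rightarrow> nat \<Rightarrow> real"
  where
    "bound_seq \<beta> \<theta> r0 0 = r0"
  | "bound_seq \<beta> \<theta> r0 (Suc k) =
      max (bound_seq \<beta> \<theta> r0 k - (1 - \<beta>) * radius \<beta> r0 k)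
          (\<theta> * bound_seq \<beta> \<theta> r0 k + (1 - \<beta>) * radius \<beta> r0 k)"

end

theory Submission
  imports Defs
begin

text \<open>
  Measure the error by \<open>M\<^sub>k = \<parallel>c\<^sub>k - x*\<parallel>\<close> in the weighted maximum norm. A coordinate whose weighted
  error exceeds \<open>\<theta> M\<^sub>k\<close> has a sign answer pointing away from \<open>x*\<close>, so it moves towards \<open>x*\<close>
  and its error shrinks by the step length \<open>(1 - \<beta>) R\<^sub>k\<close>, or else overshoots to at most that
  length. Every other coordinate starts within \<open>\<theta> M\<^sub>k\<close> and moves away by at most one step length. The
  two cases are the two arguments of the maximum that defines \<open>b\<close>, whence \<open>M\<^sub>k \<le> b\<^sub>k\<close>
  (\<open>wnorm_step_le\<close>). The class only speaks about points of \<open>B\<^sub>0\<close>; the centres stay there because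
  the step lengths telescope, \<open>\<Sum>j<k. (1 - \<beta>) R\<^sub>j = r\<^sub>0 - R\<^sub>k\<close> (\<open>cube_sign_in_box\<close>).

  The behaviour of \<open>b\<close> is read off from the excess \<open>b\<^sub>k - R\<^sub>k\<close>. As \<open>R\<^sub>k - (1 - \<beta>) R\<^sub>k = R\<^sub>k\<^sub>+\<^sub>1\<close>,
  taking the first argument of the maximum leaves the excess unchanged, so it never decreases. For
  \<open>\<theta> \<le> 2\<beta> - 1\<close> it remains \<open>0\<close>. For \<open>\<theta> > 2\<beta> - 1\<close> it is positive from the first step on, hence
  \<open>b\<^sub>k / R\<^sub>k = 1 + (b\<^sub>k - R\<^sub>k) / R\<^sub>k\<close> is nondecreasing and unbounded. The first argument attains
  the maximum exactly when this ratio is at least \<open>2 (1 - \<beta>) / (1 - \<theta>)\<close>, so from the first such index on the excess is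
  constant, and letting \<open>k\<close> tend to infinity in \<open>M\<^sub>k \<le> b\<^sub>k\<close> bounds the limiting error.
\<close>

section \<open>The weighted maximum norm\<close>

lemma wnorm_ge_component: "\<bar>u $ i\<bar> / w $ i \<le> wnorm w u"
  unfolding wnorm_def by (rule Max_ge) auto

lemma wnorm_le_iff: "wnorm w u \<le> a \<longleftrightarrow> (\<forall>i. \<bar>u $ i\<bar> / w $ i \<le> a)"
  unfolding wnorm_def by (subst Max_le_iff) auto

lemma wnorm_nonneg:
  assumes "\<And>i. w $ i > 0"
  shows "0 \<le> wnorm w u"
proof -
  have "0 \<le> \<bar>u $ i\<bar> / w $ i" for i
    using assms[of i] by simp
  then show ?thesis
    using wnorm_ge_component order_trans by blast
qed

lemma tendsto_Max_image:
  fixes g :: "'i \<Rightarrow> 'a \<Rightarrow> 'b::linorder_topology"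
  assumes "finite I" "I \<noteq> {}" and "\<And>i. i \<in> I \<Longrightarrow> (g i \<longlongrightarrow> l i) F"
  shows "((\<lambda>x. MAX i\<in>I. g i x) \<longlongrightarrow> (MAX i\<in>I. l i)) F"
  using assms
proof (induction I rule: finite_ne_induct)
  case (singleton i)
  then show ?case by simp
next
  case (insert i I)
  then show ?case by (simp add: tendsto_max)
qed

lemma tendsto_wnorm:
  assumes "\<And>i. w $ i > 0" and "(u \<longlongrightarrow> l) F"
  shows "((\<lambda>x. wnorm w (u x)) \<longlongrightarrow> wnorm w l) F"
proof -
  have "((\<lambda>x. \<bar>u x $ i\<bar> / w $ i) \<longlongrightarrow> \<bar>l $ i\<bar> / w $ i) F" for i
    using assms(1)[of i] by (intro tendsto_intros assms(2)) simp
  then show ?thesis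
    unfolding wnorm_def by (intro tendsto_Max_image) auto
qed

section \<open>The radii\<close>

lemma radius_0 [simp]: "radius \<beta> r0 0 = r0"
  by (simp add: radius_def)

lemma radius_Suc: "radius \<beta> r0 (Suc k) = radius \<beta> r0 k - (1 - \<beta>) * radius \<beta> r0 k"
  by (simp add: radius_def algebra_simps)

lemma radius_pos: "0 < \<beta> \<Longrightarrow> 0 < r0 \<Longrightarrow> 0 < radius \<beta> r0 k"
  by (simp add: radius_def)

lemma radius_tendsto_0:
  assumes "\<bar>\<beta>\<bar> < 1"
  shows "radius \<beta> r0 \<longlonglongrightarrow> 0"
proof -
  have "(\<lambda>k. \<beta> ^ k * r0) \<longlonglongrightarrow> 0 * r0"
    using assms by (intro tendsto_intros LIMSEQ_power_zero) simp
  then show ?thesis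
    by (simp add: radius_def[abs_def])
qed

section \<open>The centres\<close>

lemma cube_sign_0 [simp]: "cube_sign \<beta> w \<tau> f c0 r0 0 = c0"
  by (simp add: cube_sign_def)

text \<open>
  All that the analysis needs to know about a step: whatever the transcript and the tie rule, the
  signs are \<open>\<plusminus>1\<close> and agree with the nonzero sign answers at the current centre.
\<close>

lemma cube_sign_Suc:
  fixes \<tau> :: "('n::finite) tie_rule"
  assumes "is_tie_rule \<tau>"
  obtains s :: "real ^ 'n" where
    "cube_sign \<beta> w \<tau> f c0 r0 (Suc k) =
       cube_sign \<beta> w \<tau> f c0 r0 k - ((1 - \<beta>) * radius \<beta> r0 k) *\<^sub>R (\<chi> i. w $ i * s $ i)"
    and "\<And>i. s $ i = 1 \<or> s $ i = -1"
    and "\<And>i. partial_deriv f i (cube_sign \<beta> w \<tau> f c0 r0 k) \<noteq> 0 \<Longrightarrow>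
           s $ i = sgn (partial_deriv f i (cube_sign \<beta> w \<tau> f c0 r0 k))"
proof -
  obtain x h where xh: "cube_sign_state \<beta> w \<tau> f c0 r0 k = (x, h)"
    by (cases "cube_sign_state \<beta> w \<tau> f c0 r0 k")
  then have x: "cube_sign \<beta> w \<tau> f c0 r0 k = x"
    by (simp add: cube_sign_def)
  define s where "s = chosen_signs \<tau> h x (sign_answers f x)"
  show ?thesis
  proof
    show "cube_sign \<beta> w \<tau> f c0 r0 (Suc k) =
        cube_sign \<beta> w \<tau> f c0 r0 k - ((1 - \<beta>) * radius \<beta> r0 k) *\<^sub>R (\<chi> i. w $ i * s $ i)"
      using xh by (simp add: x) (simp add: cube_sign_def s_def Let_def)
    show "s $ i = 1 \<or> s $ i = -1" for i
      using assms
      by (auto simp: s_def chosen_signs_def sign_answers_def is_tie_rule_def sgn_real_def)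
    show "s $ i = sgn (partial_deriv f i (cube_sign \<beta> w \<tau> f c0 r0 k))"
      if "partial_deriv f i (cube_sign \<beta> w \<tau> f c0 r0 k) \<noteq> 0" for i
      using that by (simp add: x s_def chosen_signs_def sign_answers_def sgn_zero_iff)
  qed
qed

lemma cube_sign_dist_start:
  fixes \<tau> :: "('n::finite) tie_rule"
  assumes "\<And>i. w $ i > 0" and "0 < \<beta>" "\<beta> \<le> 1" and "r0 > 0" and "is_tie_rule \<tau>"
  shows "\<bar>cube_sign \<beta> w \<tau> f c0 r0 k $ i - c0 $ i\<bar> \<le> (r0 - radius \<beta> r0 k) * w $ i"
proof (induction k)
  case 0
  then show ?case by simp
next
  case (Suc k)
  let ?c = "cube_sign \<beta> w \<tau> f c0 r0" and ?h = "(1 - \<beta>) * radius \<beta> r0 k"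
  obtain s where s: "?c (Suc k) = ?c k - ?h *\<^sub>R (\<chi> i. w $ i * s $ i)"
    and pm: "\<And>i. s $ i = 1 \<or> s $ i = -1"
    using cube_sign_Suc[OF assms(5), where \<beta>=\<beta> and w=w and f=f and ?c0.0=c0 and ?r0.0=r0 and k=k]
    by metis
  have "0 \<le> ?h * w $ i"
    using assms(1)[of i] assms(3) radius_pos[OF assms(2,4), of k] by simp
  then have "\<bar>?c (Suc k) $ i - c0 $ i\<bar> \<le> \<bar>?c k $ i - c0 $ i\<bar> + ?h * w $ i"
    using pm[of i] by (auto simp: s algebra_simps)
  also have "\<dots> \<le> (r0 - radius \<beta> r0 (Suc k)) * w $ i"
    using Suc.IH by (simp add: radius_Suc algebra_simps)
  finally show ?case .
qed

lemma cube_sign_in_box: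
  fixes \<tau> :: "('n::finite) tie_rule"
  assumes "\<And>i. w $ i > 0" and "0 < \<beta>" "\<beta> \<le> 1" and "r0 > 0" and "is_tie_rule \<tau>"
  shows "cube_sign \<beta> w \<tau> f c0 r0 k \<in> coord_box c0 (r0 *\<^sub>R w)"
proof -
  have "(r0 - radius \<beta> r0 k) * w $ i \<le> r0 * w $ i" for i
    using assms(1)[of i] radius_pos[OF assms(2,4), of k] by (intro mult_right_mono) auto
  then have "\<bar>cube_sign \<beta> w \<tau> f c0 r0 k $ i - c0 $ i\<bar> \<le> r0 * w $ i" for i
    using cube_sign_dist_start[OF assms] order_trans by blast
  then show ?thesis
    by (simp add: coord_box_def)
qed

lemma convergent_cube_sign:
  fixes \<tau> :: "('n::finite) tie_rule"
  assumes "\<bar>\<beta>\<bar> < 1" and "is_tie_rule \<tau>"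
  shows "convergent (cube_sign \<beta> w \<tau> f c0 r0)"
proof -
  let ?c = "cube_sign \<beta> w \<tau> f c0 r0"
  have step: "norm (?c (Suc k) - ?c k) = \<bar>(1 - \<beta>) * r0\<bar> * norm w * \<bar>\<beta>\<bar> ^ k" for k
  proof -
    obtain s where s: "?c (Suc k) = ?c k - ((1 - \<beta>) * radius \<beta> r0 k) *\<^sub>R (\<chi> i. w $ i * s $ i)"
      and pm: "\<And>i. s $ i = 1 \<or> s $ i = -1"
      using cube_sign_Suc[OF assms(2), where \<beta>=\<beta> and w=w and f=f and ?c0.0=c0 and ?r0.0=r0 and k=k]
      by metis
    have "\<bar>w $ i * s $ i\<bar> = \<bar>w $ i\<bar>" for i
      using pm[of i] by auto
    then have "norm (\<chi> i. w $ i * s $ i) = norm w"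
      by (simp add: norm_vec_def)
    then show ?thesis
      by (simp add: s radius_def abs_mult power_abs)
  qed
  have "summable (\<lambda>k. \<bar>(1 - \<beta>) * r0\<bar> * norm w * \<bar>\<beta>\<bar> ^ k)"
    using assms(1) by (intro summable_mult summable_geometric) simp
  then have "summable (\<lambda>k. ?c (Suc k) - ?c k)"
    unfolding step[symmetric] by (rule summable_norm_cancel)
  then have "convergent (\<lambda>k. (\<Sum>j<k. ?c (Suc j) - ?c j) + c0)"
    by (intro convergent_add convergent_const) (simp add: summable_iff_convergent)
  then show ?thesis
    by (simp add: sum_lessThan_telescope)
qed

section \<open>One step against the defect class\<close>

text \<open>
  In units of \<open>w\<close>, \<open>a\<close> is the signed error of one coordinate, \<open>h\<close> the step length and \<open>s\<close> the sign
  used. If the error exceeds \<open>t\<close> the sign is right, and the error becomes \<open>\<bar>\<bar>a\<bar> - h\<bar>\<close>; an overshoot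
  is then at most \<open>h\<close>, which the second argument already covers.
\<close>

lemma signed_step_le:
  fixes a h s t m :: real
  assumes "\<bar>a\<bar> \<le> m" and "0 \<le> h" and "0 \<le> t" and "s = 1 \<or> s = -1"
    and "\<bar>a\<bar> > t \<Longrightarrow> s * a > 0"
  shows "\<bar>a - h * s\<bar> \<le> max (m - h) (t + h)"
  using assms by (cases "\<bar>a\<bar> > t") (auto simp: max_def abs_if split: if_splits)

lemma wnorm_step_le:
  fixes w x xs s :: "real ^ 'n"
  assumes w: "\<And>i. w $ i > 0" and "0 \<le> \<theta>" and h: "0 \<le> h" and le: "wnorm w (x - xs) \<le> m"
    and pm: "\<And>i. s $ i = 1 \<or> s $ i = -1"
    and sgn: "\<And>i. \<bar>x $ i - xs $ i\<bar> / w $ i > \<theta> * wnorm w (x - xs) \<Longrightarrow> s $ i * (x $ i - xs $ i) > 0"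
  shows "wnorm w (x - h *\<^sub>R (\<chi> i. w $ i * s $ i) - xs) \<le> max (m - h) (\<theta> * m + h)"
  unfolding wnorm_le_iff
proof
  fix i
  let ?a = "(x $ i - xs $ i) / w $ i" and ?t = "\<theta> * wnorm w (x - xs)"
  have abs_a: "\<bar>?a\<bar> = \<bar>x $ i - xs $ i\<bar> / w $ i"
    using w[of i] by simp
  have "\<bar>?a - h * s $ i\<bar> \<le> max (m - h) (?t + h)"
  proof (rule signed_step_le)
    show "\<bar>?a\<bar> \<le> m"
      using order_trans[OF wnorm_ge_component[of "x - xs" i w] le]
      unfolding abs_a by (simp only: vector_minus_component)
    show "0 \<le> ?t"
      using \<open>0 \<le> \<theta>\<close> wnorm_nonneg[OF w] by simp
    show "s $ i * ?a > 0" if "\<bar>?a\<bar> > ?t"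
      using sgn[of i] that w[of i] unfolding abs_a by (simp add: zero_less_divide_iff)
  qed (use h pm in auto)
  also have "\<dots> \<le> max (m - h) (\<theta> * m + h)"
    using mult_left_mono[OF le \<open>0 \<le> \<theta>\<close>] by auto
  also have "?a - h * s $ i = (x - h *\<^sub>R (\<chi> i. w $ i * s $ i) - xs) $ i / w $ i"
    using w[of i] by (simp add: field_simps)
  finally show "\<bar>(x - h *\<^sub>R (\<chi> i. w $ i * s $ i) - xs) $ i\<bar> / w $ i \<le> max (m - h) (\<theta> * m + h)"
    using w[of i] by simp
qed

lemma wnorm_cube_sign_le_bound_seq:
  fixes \<tau> :: "('n::finite) tie_rule"
  assumes w: "\<And>i. w $ i > 0" and beta: "0 < \<beta>" "\<beta> \<le> 1" and theta: "0 \<le> \<theta>" and r0: "r0 > 0"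
    and xs: "xs \<in> coord_box c0 (r0 *\<^sub>R w)"
    and f: "f \<in> defect_class w \<theta> xs (coord_box c0 (r0 *\<^sub>R w))"
    and tie: "is_tie_rule \<tau>"
  shows "wnorm w (cube_sign \<beta> w \<tau> f c0 r0 k - xs) \<le> bound_seq \<beta> \<theta> r0 k"
proof (induction k)
  case 0
  have "\<bar>c0 $ i - xs $ i\<bar> \<le> r0 * w $ i" for i
    using xs by (auto simp: coord_box_def abs_minus_commute)
  then show ?case
    using w by (simp add: wnorm_le_iff pos_divide_le_eq)
next
  case (Suc k)
  let ?x = "cube_sign \<beta> w \<tau> f c0 r0 k" and ?h = "(1 - \<beta>) * radius \<beta> r0 k"
  obtain s where s: "cube_sign \<beta> w \<tau> f c0 r0 (Suc k) = ?x - ?h *\<^sub>R (\<chi> i. w $ i * s $ i)"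
    and pm: "\<And>i. s $ i = 1 \<or> s $ i = -1"
    and ans: "\<And>i. partial_deriv f i ?x \<noteq> 0 \<Longrightarrow> s $ i = sgn (partial_deriv f i ?x)"
    using cube_sign_Suc[OF tie, where \<beta>=\<beta> and w=w and f=f and ?c0.0=c0 and ?r0.0=r0 and k=k]
    by metis
  have "s $ i * (?x $ i - xs $ i) > 0"
    if "\<bar>?x $ i - xs $ i\<bar> / w $ i > \<theta> * wnorm w (?x - xs)" for i
  proof -
    have "partial_deriv f i ?x * (?x $ i - xs $ i) > 0"
      using f that cube_sign_in_box[OF w beta r0 tie] by (auto simp: defect_class_def)
    then show ?thesis
      using ans[of i] by (auto simp: zero_less_mult_iff)
  qed
  moreover have "0 \<le> ?h"
    using beta radius_pos[OF beta(1) r0, of k] by simp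
  ultimately show ?case
    unfolding s bound_seq.simps using w theta pm Suc.IH by (intro wnorm_step_le)
qed

section \<open>The excess of the bound over the radius\<close>

lemma excess_mono: "incseq (\<lambda>k. bound_seq \<beta> \<theta> r0 k - radius \<beta> r0 k)"
  by (rule incseq_SucI) (simp add: radius_Suc)

lemma radius_le_bound_seq: "radius \<beta> r0 k \<le> bound_seq \<beta> \<theta> r0 k"
  using incseqD[OF excess_mono[of \<beta> \<theta> r0], of 0 k] by simp

lemma bound_seq_eq_radius:
  assumes "0 < \<beta>" "r0 > 0" and "\<theta> \<le> 2 * \<beta> - 1"
  shows "bound_seq \<beta> \<theta> r0 k = radius \<beta> r0 k"
proof (induction k)
  case 0
  then show ?case by simp
next
  case (Suc k)
  have "(\<theta> + (1 - \<beta>)) * radius \<beta> r0 k \<le> (1 - (1 - \<beta>)) * radius \<beta> r0 k"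
    using assms(3) radius_pos[OF assms(1,2), of k] by (intro mult_right_mono) auto
  then show ?case
    by (simp add: Suc radius_Suc max_def algebra_simps)
qed

text \<open>The excess is at least \<open>(\<theta> - (2\<beta> - 1)) r\<^sub>0\<close> after one step, while the radii tend to \<open>0\<close>.\<close>

lemma bound_seq_ratio_unbounded:
  assumes "0 < \<beta>" "\<beta> < 1" "r0 > 0" and "\<theta> > 2 * \<beta> - 1"
  shows "\<exists>k. bound_seq \<beta> \<theta> r0 k / radius \<beta> r0 k \<ge> q"
proof -
  let ?b = "bound_seq \<beta> \<theta> r0" and ?R = "radius \<beta> r0"
  define d where "d = (\<theta> - (2 * \<beta> - 1)) * r0"
  have "0 < d"
    using assms by (simp add: d_def)
  have "?R \<longlonglongrightarrow> 0"
    using assms by (intro radius_tendsto_0) simp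
  moreover have "0 < d / (\<bar>q\<bar> + 1)"
    using \<open>0 < d\<close> by (intro divide_pos_pos) auto
  ultimately have "\<forall>\<^sub>F k in sequentially. ?R k < d / (\<bar>q\<bar> + 1)"
    by (rule order_tendstoD)
  then have "\<forall>\<^sub>F k in sequentially. ?R k < d / (\<bar>q\<bar> + 1) \<and> 1 \<le> k"
    using eventually_ge_at_top by (rule eventually_conj)
  then obtain k where k: "?R k < d / (\<bar>q\<bar> + 1)" "1 \<le> k"
    using eventually_happens' sequentially_bot by blast
  have pos: "0 < ?R k"
    using assms by (simp add: radius_pos)
  have "d \<le> ?b 1 - ?R 1"
    by (simp add: d_def radius_def algebra_simps max_def)
  also have "\<dots> \<le> ?b k - ?R k"
    using incseqD[OF excess_mono k(2)] .
  finally have "d \<le> ?b k"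
    using pos by simp
  have "q * ?R k \<le> (\<bar>q\<bar> + 1) * ?R k"
    using pos by (intro mult_right_mono) auto
  also have "\<dots> \<le> d"
    using k(1) by (simp add: field_simps)
  finally show ?thesis
    using \<open>d \<le> ?b k\<close> pos by (intro exI[of _ k]) (simp add: pos_le_divide_eq)
qed

lemma bound_seq_first_arg_iff:
  assumes "0 < \<beta>" "r0 > 0" and "\<theta> < 1"
  shows "\<theta> * bound_seq \<beta> \<theta> r0 k + (1 - \<beta>) * radius \<beta> r0 k
           \<le> bound_seq \<beta> \<theta> r0 k - (1 - \<beta>) * radius \<beta> r0 k
         \<longleftrightarrow> bound_seq \<beta> \<theta> r0 k / radius \<beta> r0 k \<ge> 2 * (1 - \<beta>) / (1 - \<theta>)"
  using radius_pos[OF assms(1,2), of k] assms(3) by (simp add: field_simps)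

text \<open>The ratio is \<open>1\<close> plus a nonnegative nondecreasing excess over a decreasing radius.\<close>

lemma bound_seq_ratio_mono:
  assumes "0 < \<beta>" "\<beta> \<le> 1" "r0 > 0"
  shows "incseq (\<lambda>k. bound_seq \<beta> \<theta> r0 k / radius \<beta> r0 k)"
proof (rule incseq_SucI)
  fix k
  let ?b = "bound_seq \<beta> \<theta> r0" and ?R = "radius \<beta> r0"
  have pos: "0 < ?R j" for j
    using assms by (simp add: radius_pos)
  have split: "?b j / ?R j = 1 + (?b j - ?R j) / ?R j" for j
    using pos[of j] by (simp add: field_simps)
  have "?R (Suc k) \<le> ?R k"
    using assms pos[of k] by (simp add: radius_Suc)
  then have "(?b k - ?R k) / ?R k \<le> (?b (Suc k) - ?R (Suc k)) / ?R (Suc k)"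
    using pos incseqD[OF excess_mono, of k "Suc k"] radius_le_bound_seq
    by (intro frac_le) (auto simp del: bound_seq.simps)
  then show "?b k / ?R k \<le> ?b (Suc k) / ?R (Suc k)"
    unfolding split by simp
qed

lemma bound_seq_eventually_eq:
  assumes "0 < \<beta>" "\<beta> \<le> 1" "r0 > 0" "\<theta> < 1"
    and J: "bound_seq \<beta> \<theta> r0 J / radius \<beta> r0 J \<ge> 2 * (1 - \<beta>) / (1 - \<theta>)" and "J \<le> k"
  shows "bound_seq \<beta> \<theta> r0 k = bound_seq \<beta> \<theta> r0 J - radius \<beta> r0 J + radius \<beta> r0 k"
  using \<open>J \<le> k\<close>
proof (induction k rule: dec_induct)
  case base
  then show ?case by simp
next
  case (step k)
  have "bound_seq \<beta> \<theta> r0 k / radius \<beta> r0 k \<ge> 2 * (1 - \<beta>) / (1 - \<theta>)"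
    using J incseqD[OF bound_seq_ratio_mono[OF assms(1-3)] step.hyps(1)] by (rule order_trans)
  then have "bound_seq \<beta> \<theta> r0 (Suc k) = bound_seq \<beta> \<theta> r0 k - (1 - \<beta>) * radius \<beta> r0 k"
    unfolding bound_seq_first_arg_iff[OF assms(1,3,4), symmetric] bound_seq.simps
    by (rule max_absorb1)
  then show ?case
    using step.IH by (simp only: radius_Suc)
qed

section \<open>The error bound\<close>

theorem proposition3p3:
  fixes w c0 xs :: "real ^ 'n" and \<beta> \<theta> r0 :: real
    and f :: "real ^ 'n \<Rightarrow> real" and \<tau> :: "'n tie_rule"
    and R b M :: "nat \<Rightarrow> real" and c :: "nat \<Rightarrow> real ^ 'n"
  assumes w_pos: "\<And>i. w $ i > 0"
    and beta: "1 / 2 \<le> \<beta>" "\<beta> < 1"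
    and theta: "0 \<le> \<theta>" "\<theta> < 1"
    and r0_pos: "r0 > 0"
    and xs_in: "xs \<in> coord_box c0 (r0 *\<^sub>R w)"
    and f_in: "f \<in> defect_class w \<theta> xs (coord_box c0 (r0 *\<^sub>R w))"
    and tie: "is_tie_rule \<tau>"
  defines "R \<equiv> radius \<beta> r0"
    and "b \<equiv> bound_seq \<beta> \<theta> r0"
    and "c \<equiv> cube_sign \<beta> w \<tau> f c0 r0"
    and "M \<equiv> (\<lambda>k. wnorm w (c k - xs))"
  shows "(\<forall>k. M k \<le> b k)
    \<and> convergent c \<and> convergent M \<and> lim M = wnorm w (lim c - xs)
    \<and> (\<theta> \<le> 2 * \<beta> - 1 \<longrightarrow> (\<forall>k. b k = R k))
    \<and> (\<theta> > 2 * \<beta> - 1 \<longrightarrow>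
        (\<exists>k. b k / R k \<ge> 2 * (1 - \<beta>) / (1 - \<theta>))
        \<and> (let J = (LEAST k. b k / R k \<ge> 2 * (1 - \<beta>) / (1 - \<theta>)) in
            (\<forall>k\<ge>J. b k - (1 - \<beta>) * R k \<ge> \<theta> * b k + (1 - \<beta>) * R k)
            \<and> (\<forall>k\<ge>J. b k = b J - R J + R k)
            \<and> lim M \<le> b J - R J))"
proof -
  have beta0: "0 < \<beta>" and beta1: "\<beta> \<le> 1" and beta_abs: "\<bar>\<beta>\<bar> < 1"
    using beta by auto
  have M_le: "M k \<le> b k" for k
    unfolding M_def b_def c_def
    by (rule wnorm_cube_sign_le_bound_seq[OF w_pos beta0 beta1 theta(1) r0_pos xs_in f_in tie])
  have conv_c: "convergent c"
    unfolding c_def using beta_abs tie by (rule convergent_cube_sign)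
  then have "(\<lambda>k. c k - xs) \<longlonglongrightarrow> lim c - xs"
    by (intro tendsto_intros) (simp add: convergent_LIMSEQ_iff)
  then have M_lim: "M \<longlonglongrightarrow> wnorm w (lim c - xs)"
    unfolding M_def using w_pos by (rule tendsto_wnorm[rotated])
  have small: "\<forall>k. b k = R k" if "\<theta> \<le> 2 * \<beta> - 1"
    unfolding b_def R_def using bound_seq_eq_radius[OF beta0 r0_pos that] by blast
  have large: "(\<exists>k. b k / R k \<ge> 2 * (1 - \<beta>) / (1 - \<theta>))
        \<and> (let J = (LEAST k. b k / R k \<ge> 2 * (1 - \<beta>) / (1 - \<theta>)) in
            (\<forall>k\<ge>J. b k - (1 - \<beta>) * R k \<ge> \<theta> * b k + (1 - \<beta>) * R k)
            \<and> (\<forall>k\<ge>J. b k = b J - R J + R k)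
            \<and> lim M \<le> b J - R J)" if "\<theta> > 2 * \<beta> - 1"
  proof -
    have ex: "\<exists>k. b k / R k \<ge> 2 * (1 - \<beta>) / (1 - \<theta>)"
      unfolding b_def R_def using beta0 beta(2) r0_pos that by (rule bound_seq_ratio_unbounded)
    define J where "J = (LEAST k. b k / R k \<ge> 2 * (1 - \<beta>) / (1 - \<theta>))"
    have J: "b J / R J \<ge> 2 * (1 - \<beta>) / (1 - \<theta>)"
      unfolding J_def using ex by (rule LeastI_ex)
    have first: "b k - (1 - \<beta>) * R k \<ge> \<theta> * b k + (1 - \<beta>) * R k" if "k \<ge> J" for k
    proof -
      have "b k / R k \<ge> 2 * (1 - \<beta>) / (1 - \<theta>)"
        using J incseqD[OF bound_seq_ratio_mono[OF beta0 beta1 r0_pos] that]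
        unfolding b_def R_def by (rule order_trans)
      then show ?thesis
        unfolding b_def R_def by (simp only: bound_seq_first_arg_iff[OF beta0 r0_pos theta(2)])
    qed
    have closed: "b k = b J - R J + R k" if "k \<ge> J" for k
      using J that unfolding b_def R_def
      by (rule bound_seq_eventually_eq[OF beta0 beta1 r0_pos theta(2)])
    have "R \<longlonglongrightarrow> 0"
      unfolding R_def using beta_abs by (rule radius_tendsto_0)
    then have "(\<lambda>k. b J - R J + R k) \<longlonglongrightarrow> b J - R J + 0"
      by (intro tendsto_intros)
    moreover have "M k \<le> b J - R J + R k" if "k \<ge> J" for k
      using M_le[of k] closed[OF that] by simp
    ultimately have "wnorm w (lim c - xs) \<le> b J - R J + 0"
      using M_lim by (intro LIMSEQ_le) auto
    then have "lim M \<le> b J - R J"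
      using limI[OF M_lim] by simp
    with ex first closed show ?thesis
      unfolding Let_def J_def[symmetric] by blast
  qed
  show ?thesis
    using M_le conv_c convergentI[OF M_lim] limI[OF M_lim] small large by blast
qed

end
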